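(* Let $G$ be a bi-directed graph with finite vertex set $V$. Let $A\subseteq V$ be a simplicial set, let $S\in\mathbb{R}^{V\times V}$ be a symmetric positive definite matrix, and let $\hat\Sigma(S)\in\mathbf{P}(G)$ be a solution to the likelihood equations of the covariance graph model associated with $G$. Then $\hat\Sigma(S)_{A\times A}=S_{A\times A}$.
   Context: A bi-directed graph $G$ has a finite vertex set $V$ and at most one edge between any two distinct vertices (no loops), all edges being bi-directed, written $v\leftrightarrow w$ (a symmetric relation). For $A\subseteq V$, $\mathrm{Bd}(A)$ is the union of $A$ and the set of vertices adjacent to some vertex of $A$. The set $A$ is simplicial if every two distinct vertices of $\mathrm{Bd}(A)$ are adjacent. $\mathbf{P}(G)$ is the set of symmetric positive definite matrices $\Sigma=(\sigma_{vw})\in\mathbb{R}^{V\times V}$ with $\sigma_{vw}=0$ for all $v\neq w$ such that $v\leftrightarrow w\notin G$. The covariance graph model associated with $G$ is the family of centered multivariate normal distributions $\mathcal{N}_V(0,\Sigma)$, $\Sigma\in\mathbf{P}(G)$. Its log-likelihood function for sample size $n$ and empirical covariance matrix $S$ is $\ell_{S,n}(\Sigma)=-\frac{n|V|}{2}\log(2\pi)-\frac n2\log|\Sigma|-\frac n2\mathrm{tr}(\Sigma^{-1}S)$. A solution to the likelihood equations is a matrix $\Sigma\in\mathbf{P}(G)$ satisfying $$(\Sigma^{-1})_{vw}=(\Sigma^{-1}S\Sigma^{-1})_{vw}\quad\text{for all } v,w\in V \text{ with } v=w \text{ or } v\leftrightarrow w\in G.$$ For a matrix $M$, $M_{A\times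 A}$ denotes the submatrix with rows and columns indexed by $A$. *)

theory Defs
  imports "HOL-Analysis.Analysis"
begin

text \<open>
  The finite vertex set is the universe of a type of class finite, so that matrices indexed by
  vertices are matrices of HOL-Analysis. A bi-directed graph is given by its set of edges,
  stored as ordered pairs: an edge between \<open>v\<close> and \<open>w\<close> contributes both orientations.
\<close>

definition bidirected_graph :: "('v::finite) rel \<Rightarrow> bool" where
  "bidirected_graph G \<longleftrightarrow> sym G \<and> irrefl G"

definition Bd :: "('v::finite) rel \<Rightarrow> 'v set \<Rightarrow> 'v set" where
  "Bd G A = A \<union> {v. \<exists>a\<in>A. (a, v) \<in> G}"

definition simplicial :: "('v::finite) rel \<Rightarrow> 'v set \<Rightarrow> bool" where
  "simplicial G A \<longleftrightarrow> (\<forall>v\<in>Bd G A. \<forall>w\<in>Bd G A. v \<noteq> w \<longrightarrow> (v, w) \<in> G)"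

definition sym_pos_def :: "real^'v^'v \<Rightarrow> bool" where
  "sym_pos_def M \<longleftrightarrow> transpose M = M \<and> (\<forall>x. x \<noteq> 0 \<longrightarrow> x \<bullet> (M *v x) > 0)"

definition cov_matrices :: "('v::finite) rel \<Rightarrow> (real^'v^'v) set" where
  "cov_matrices G = {\<Sigma>. sym_pos_def \<Sigma> \<and> (\<forall>v w. v \<noteq> w \<and> (v, w) \<notin> G \<longrightarrow> \<Sigma> $ v $ w = 0)}"

definition likelihood_solution :: "('v::finite) rel \<Rightarrow> real^'v^'v \<Rightarrow> real^'v^'v \<Rightarrow> bool" where
  "likelihood_solution G S \<Sigma> \<longleftrightarrow> \<Sigma> \<in> cov_matrices G \<and>
    (\<forall>v w. v = w \<or> (v, w) \<in> G \<longrightarrow>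
      matrix_inv \<Sigma> $ v $ w = (matrix_inv \<Sigma> ** S ** matrix_inv \<Sigma>) $ v $ w)"

text \<open>
  A submatrix is a function on index pairs that is \<^term>\<open>undefined\<close> outside of \<open>A \<times> A\<close>, so that
  equality of submatrices is equality of the entries indexed by \<open>A \<times> A\<close>.
\<close>

definition principal_submatrix :: "real^'v^'v \<Rightarrow> 'v set \<Rightarrow> 'v \<times> 'v \<Rightarrow> real" where
  "principal_submatrix M A = (\<lambda>(v, w)\<in>A \<times> A. M $ v $ w)"

end

theory Submission imports Defs begin

text \<open>
  Put \<open>D = \<Sigma>\<inverse> - \<Sigma>\<inverse> S \<Sigma>\<inverse>\<close>, so that \<open>\<Sigma> - S = \<Sigma> D \<Sigma>\<close>. In an entry of \<open>\<Sigma> D \<Sigma>\<close> with indices in \<open>A\<close>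
  the zeros of \<open>\<Sigma>\<close> leave only those entries of \<open>D\<close> that are indexed by \<open>Bd(A) \<times> Bd(A)\<close>, and
  these vanish by the likelihood equations because \<open>A\<close> is simplicial.
\<close>

text \<open>A nonzero \<open>x\<close> in the kernel would give
  \<open>x \<bullet> (M *v x) = 0\<close>, against positivity; a square matrix with trivial kernel
  is invertible.\<close>

lemma sym_pos_def_invertible:
  assumes "sym_pos_def M"
  shows "invertible M"
  unfolding invertible_left_inverse matrix_left_invertible_ker
  using assms unfolding sym_pos_def_def by (metis inner_zero_right less_irrefl)

lemma matrix_diff_ldistrib:
  fixes B C :: "'a::ring_1^'p^'n"
  shows "A ** (B - C) = A ** B - A ** C"
  by (simp add: vec_eq_iff matrix_matrix_mult_def right_diff_distrib sum_subtractf)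

lemma matrix_diff_rdistrib:
  fixes A B :: "'a::ring_1^'n^'m"
  shows "(A - B) ** C = A ** C - B ** C"
  by (simp add: vec_eq_iff matrix_matrix_mult_def left_diff_distrib sum_subtractf)

lemma matrix_inv_sandwich:
  fixes S \<Sigma> :: "real^'n^'n"
  assumes "invertible \<Sigma>"
  shows "\<Sigma> ** (matrix_inv \<Sigma> - matrix_inv \<Sigma> ** S ** matrix_inv \<Sigma>) ** \<Sigma> = \<Sigma> - S"
proof -
  \<comment> \<open>\<open>matrix_inv\<close> is a Hilbert choice among two-sided inverses;
    invertibility makes this choice nonempty.\<close>
  have r: "\<Sigma> ** matrix_inv \<Sigma> = mat 1" and l: "matrix_inv \<Sigma> ** \<Sigma> = mat 1"
    using assms unfolding invertible_def matrix_inv_def by (metis (mono_tags, lifting) someI_ex)+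
  have "\<Sigma> ** (matrix_inv \<Sigma> ** S ** matrix_inv \<Sigma>) ** \<Sigma>
      = (\<Sigma> ** matrix_inv \<Sigma>) ** S ** (matrix_inv \<Sigma> ** \<Sigma>)"
    by (simp only: matrix_mul_assoc)
  then have "\<Sigma> ** (matrix_inv \<Sigma> ** S ** matrix_inv \<Sigma>) ** \<Sigma> = S"
    by (simp add: r l)
  then show ?thesis
    by (simp add: matrix_diff_ldistrib matrix_diff_rdistrib r)
qed

theorem theorem22:
  fixes G :: "('v::finite) rel" and A :: "'v set" and S \<Sigma> :: "real^'v^'v"
  assumes "bidirected_graph G"
    and "simplicial G A"
    and "sym_pos_def S"
    and "likelihood_solution G S \<Sigma>"
  shows "principal_submatrix \<Sigma> A = principal_submatrix S A"
proof -
  define D where "D = matrix_inv \<Sigma> - matrix_inv \<Sigma> ** S ** matrix_inv \<Sigma>"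
  have "sym G"
    using assms(1) by (simp add: bidirected_graph_def)
  have \<Sigma>: "\<Sigma> \<in> cov_matrices G"
    using assms(4) by (simp add: likelihood_solution_def)
  then have "invertible \<Sigma>"
    by (simp add: cov_matrices_def sym_pos_def_invertible)
  then have diff: "\<Sigma> ** D ** \<Sigma> = \<Sigma> - S"
    unfolding D_def by (rule matrix_inv_sandwich)
  have D0: "D $ v $ w = 0" if "v \<in> Bd G A" "w \<in> Bd G A" for v w
  proof -
    \<comment> \<open>Simpliciality supplies the edge for distinct vertices; the diagonal has its
      own likelihood equations.\<close>
    have "v = w \<or> (v, w) \<in> G"
      using that assms(2) unfolding simplicial_def by blast
    then show ?thesis
      using assms(4) unfolding likelihood_solution_def D_def by auto
  qed
  have row0: "\<Sigma> $ a $ v = 0" if "a \<in> A" "v \<notin> Bd G A" for a v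
  proof -
    have "a \<noteq> v" and "(a, v) \<notin> G"
      using that unfolding Bd_def by auto
    then show ?thesis
      using \<Sigma> unfolding cov_matrices_def by simp
  qed
  have col0: "\<Sigma> $ v $ a = 0" if "a \<in> A" "v \<notin> Bd G A" for a v
  proof -
    \<comment> \<open>\<open>Bd\<close> follows edges out of \<open>A\<close>, so the reversed pair
      needs the symmetry of \<open>G\<close>.\<close>
    have "v \<noteq> a" and "(v, a) \<notin> G"
      using that \<open>sym G\<close> unfolding Bd_def by (auto dest: symD)
    then show ?thesis
      using \<Sigma> unfolding cov_matrices_def by simp
  qed
  have "\<Sigma> $ a $ b = S $ a $ b" if "a \<in> A" "b \<in> A" for a b
  proof -
    \<comment> \<open>If \<open>v\<close> lies outside \<open>Bd G A\<close>, the first factor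
      vanishes; if \<open>w\<close> does, the last; otherwise the middle one.\<close>
    have "\<Sigma> $ a $ v * D $ v $ w * \<Sigma> $ w $ b = 0" for v w
      using D0 row0 col0 that by (metis mult_zero_left mult_zero_right)
    then have "(\<Sigma> ** D ** \<Sigma>) $ a $ b = 0"
      by (simp only: matrix_matrix_mult_def vec_lambda_beta sum_distrib_right sum.neutral_const)
    then show ?thesis
      by (simp add: diff)
  qed
  then show ?thesis
    unfolding principal_submatrix_def by (auto intro!: restrict_ext)
qed

end
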